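(* For every $n\ge 2$, the stringy group $VS_n$ is isomorphic to the virtual braid group $VB_n$.
   Context: The virtual braid group $VB_n$ is the group with generators $\sigma_1,\dots,\sigma_{n-1},v_1,\dots,v_{n-1}$ and relations (for all indices for which they make sense): (B1) $\sigma_i\sigma_{i+1}\sigma_i=\sigma_{i+1}\sigma_i\sigma_{i+1}$; (B2) $\sigma_i\sigma_j=\sigma_j\sigma_i$ for $|i-j|>1$; (S1) $v_iv_{i+1}v_i=v_{i+1}v_iv_{i+1}$; (S2) $v_iv_j=v_jv_i$ for $|i-j|>1$; (S3) $v_i^2=1$; (M1) $v_i\sigma_{i+1}v_i=v_{i+1}\sigma_iv_{i+1}$; (M2) $\sigma_iv_j=v_j\sigma_i$ for $|i-j|>1$. The stringy group $VS_n$ is the group with generators $\mu_{ij}$ ($1\le i\ne j\le n$) and $v_1,\dots,v_{n-1}$, and relations: (S1) $v_iv_{i+1}v_i=v_{i+1}v_iv_{i+1}$, (S2) $v_iv_j=v_jv_i$ for $|i-j|>1$, (S3) $v_i^2=1$; $\tau\mu_{ij}\tau^{-1}=\mu_{\tau(i),\tau(j)}$ for all $\tau\in S_n$ and all $i\neq j$; $\mu_{12}\mu_{13}\mu_{23}=\mu_{23}\mu_{13}\mu_{12}$ (if $n\ge 3$); $\mu_{12}\mu_{34}=\mu_{34}\mu_{12}$ (if $n\ge 4$). Here $\tau\in S_n$ is regarded as a word in the $v_i$ by writing it as a product of adjacent transpositions and replacing $(i,i+1)$ by $v_i$ (well defined by (S1)-(S3)); permutations are composed as functions (right factor applied first), so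 the relation $\tau\mu_{ij}\tau^{-1}=\mu_{\tau(i),\tau(j)}$ is equivalent to $v_k\mu_{ij}v_k=\mu_{s_k(i),s_k(j)}$ for all $k$, with $s_k=(k,k+1)$. *)

theory Defs
  imports "HOL-Algebra.Group" "HOL-Combinatorics.Permutations"
begin

section \<open>Groups given by generators and relations\<close>

text \<open>A word is a list of letters; \<open>(x, True)\<close> stands for the generator \<open>x\<close> and
  \<open>(x, False)\<close> for its formal inverse. A relation \<open>u = v\<close> is the pair \<open>(u, v)\<close>.\<close>

type_synonym 'g gword = "('g \<times> bool) list"

definition gwords :: "'g set \<Rightarrow> 'g gword set" where
  "gwords X = lists (X \<times> UNIV)"

definition gen :: "'g \<Rightarrow> 'g gword" where
  "gen x = [(x, True)]"

definition winv :: "'g gword \<Rightarrow> 'g gword" where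
  "winv w = rev (map (\<lambda>(x, e). (x, \<not> e)) w)"

inductive_set word_eq :: "'g set \<Rightarrow> ('g gword \<times> 'g gword) set \<Rightarrow> ('g gword \<times> 'g gword) set"
  for X :: "'g set" and R :: "('g gword \<times> 'g gword) set"
where
  refl: "w \<in> gwords X \<Longrightarrow> (w, w) \<in> word_eq X R"
| sym: "(u, v) \<in> word_eq X R \<Longrightarrow> (v, u) \<in> word_eq X R"
| trans: "(u, v) \<in> word_eq X R \<Longrightarrow> (v, w) \<in> word_eq X R \<Longrightarrow> (u, w) \<in> word_eq X R"
| cancel: "x \<in> X \<Longrightarrow> u \<in> gwords X \<Longrightarrow> v \<in> gwords X \<Longrightarrow>
    (u @ [(x, e), (x, \<not> e)] @ v, u @ v) \<in> word_eq X R"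
| rel: "(r, s) \<in> R \<Longrightarrow> u \<in> gwords X \<Longrightarrow> v \<in> gwords X \<Longrightarrow>
    (u @ r @ v, u @ s @ v) \<in> word_eq X R"

text \<open>The group \<open>\<langle>X | R\<rangle>\<close>, for relations between words over \<open>X\<close>.\<close>

definition presented_group ::
    "'g set \<Rightarrow> ('g gword \<times> 'g gword) set \<Rightarrow> 'g gword set monoid" where
  "presented_group X R =
    \<lparr>carrier = gwords X // word_eq X R,
     monoid.mult = (\<lambda>A B. \<Union>a\<in>A. \<Union>b\<in>B. word_eq X R `` {a @ b}),
     one = word_eq X R `` {[]}\<rparr>"

context
  fixes X :: "'g set" and R :: "('g gword \<times> 'g gword) set"
  assumes R_words: "R \<subseteq> gwords X \<times> gwords X"
begin

lemma word_eq_words: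
  assumes "(u, v) \<in> word_eq X R"
  shows "u \<in> gwords X \<and> v \<in> gwords X"
  using assms
proof induction
  case (rel r s u v)
  then show ?case using R_words by (auto simp: gwords_def)
qed (auto simp: gwords_def)

lemma equiv_word_eq: "equiv (gwords X) (word_eq X R)"
proof (rule equivI)
  show "word_eq X R \<subseteq> gwords X \<times> gwords X"
    using word_eq_words by auto
  show "refl_on (gwords X) (word_eq X R)"
    by (auto simp: refl_on_def intro: word_eq.refl)
  show "sym (word_eq X R)"
    by (rule symI) (rule word_eq.sym)
  show "trans (word_eq X R)"
    by (rule transI) (rule word_eq.trans)
qed

lemma word_eq_context:
  assumes "(u, v) \<in> word_eq X R" "a \<in> gwords X" "b \<in> gwords X"
  shows "(a @ u @ b, a @ v @ b) \<in> word_eq X R"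
  using assms
proof (induction)
  case (refl w)
  then show ?case by (simp add: gwords_def word_eq.refl)
next
  case (sym u v)
  then show ?case by (simp add: word_eq.sym)
next
  case (trans u v w)
  show ?case
    by (rule word_eq.trans[OF trans.IH(1)[OF trans.prems] trans.IH(2)[OF trans.prems]])
next
  case (cancel x u v e)
  then have "a @ u \<in> gwords X" "v @ b \<in> gwords X" by (auto simp: gwords_def)
  from word_eq.cancel[OF cancel(1) this, of e R] show ?case by simp
next
  case (rel r s u v)
  then have "a @ u \<in> gwords X" "v @ b \<in> gwords X" by (auto simp: gwords_def)
  from word_eq.rel[OF rel(1) this] show ?case by simp
qed

lemma word_eq_append:
  assumes "(u, u') \<in> word_eq X R" "(v, v') \<in> word_eq X R"
  shows "(u @ v, u' @ v') \<in> word_eq X R"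
proof -
  have nil: "[] \<in> gwords X" by (simp add: gwords_def)
  have "([] @ u @ v, [] @ u' @ v) \<in> word_eq X R"
    using word_eq_words[OF assms(2)] nil by (intro word_eq_context[OF assms(1)]) auto
  moreover have "(u' @ v @ [], u' @ v' @ []) \<in> word_eq X R"
    using word_eq_words[OF assms(1)] nil by (intro word_eq_context[OF assms(2)]) auto
  ultimately show ?thesis using word_eq.trans[of "u @ v" "u' @ v" X R "u' @ v'"] by simp
qed

lemma mult_presented_group:
  assumes "u \<in> gwords X" "v \<in> gwords X"
  shows "word_eq X R `` {u} \<otimes>\<^bsub>presented_group X R\<^esub> word_eq X R `` {v} = word_eq X R `` {u @ v}"
proof -
  have "word_eq X R `` {a @ b} = word_eq X R `` {u @ v}"
    if "a \<in> word_eq X R `` {u}" "b \<in> word_eq X R `` {v}" for a b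
  proof -
    have "(u @ v, a @ b) \<in> word_eq X R" using that by (intro word_eq_append) simp_all
    then show ?thesis using equiv_class_eq[OF equiv_word_eq] by metis
  qed
  moreover have "u \<in> word_eq X R `` {u}" "v \<in> word_eq X R `` {v}"
    using assms by (simp_all add: word_eq.refl)
  ultimately have "(\<Union>a\<in>word_eq X R `` {u}. \<Union>b\<in>word_eq X R `` {v}. word_eq X R `` {a @ b})
      = word_eq X R `` {u @ v}"
    by blast
  then show ?thesis by (simp add: presented_group_def)
qed

lemma word_eq_winv:
  assumes "w \<in> gwords X"
  shows "winv w \<in> gwords X" "(winv w @ w, []) \<in> word_eq X R"
proof -
  have "winv w \<in> gwords X \<and> (winv w @ w, []) \<in> word_eq X R"
    using assms
  proof (induction w)
    case Nil
    then show ?case by (auto simp: winv_def gwords_def intro: word_eq.refl)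
  next
    case (Cons y w)
    obtain x e where y: "y = (x, e)" by (cases y)
    with Cons have w: "w \<in> gwords X" "x \<in> X"
      and IH: "winv w \<in> gwords X" "(winv w @ w, []) \<in> word_eq X R"
      by (auto simp: gwords_def)
    have *: "winv (y # w) = winv w @ [(x, \<not> e)]" by (simp add: winv_def y)
    have "(winv w @ [(x, \<not> e), (x, \<not> \<not> e)] @ w, winv w @ w) \<in> word_eq X R"
      using w IH by (intro word_eq.cancel)
    with IH(2) have "(winv (y # w) @ y # w, []) \<in> word_eq X R"
      by (simp add: winv_def y) (rule word_eq.trans)
    moreover have "winv (y # w) \<in> gwords X"
      using IH w unfolding * by (auto simp: gwords_def)
    ultimately show ?case by blast
  qed
  then show "winv w \<in> gwords X" "(winv w @ w, []) \<in> word_eq X R" by auto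
qed

lemma group_presented_group: "group (presented_group X R)"
proof (rule groupI)
  let ?G = "presented_group X R" and ?c = "\<lambda>u. word_eq X R `` {u}"
  have carr: "carrier ?G = ?c ` gwords X"
    by (auto simp: presented_group_def quotient_def)
  have one: "\<one>\<^bsub>?G\<^esub> = ?c []" by (simp add: presented_group_def)
  have app: "u @ v \<in> gwords X" if "u \<in> gwords X" "v \<in> gwords X" for u v
    using that by (auto simp: gwords_def)
  have nil: "[] \<in> gwords X" by (simp add: gwords_def)
  show "\<one>\<^bsub>?G\<^esub> \<in> carrier ?G" using nil by (auto simp: one carr)
  show "x \<otimes>\<^bsub>?G\<^esub> y \<in> carrier ?G" if "x \<in> carrier ?G" "y \<in> carrier ?G" for x y
    using that app unfolding carr by (auto simp: mult_presented_group)
  show "x \<otimes>\<^bsub>?G\<^esub> y \<otimes>\<^bsub>?G\<^esub> z = x \<otimes>\<^bsub>?G\<^esub> (y \<otimes>\<^bsub>?G\<^esub> z)"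
    if "x \<in> carrier ?G" "y \<in> carrier ?G" "z \<in> carrier ?G" for x y z
    using that app unfolding carr by (auto simp: mult_presented_group)
  show "\<one>\<^bsub>?G\<^esub> \<otimes>\<^bsub>?G\<^esub> x = x" if "x \<in> carrier ?G" for x
    using that nil unfolding carr one by (auto simp: mult_presented_group)
  show "\<exists>y\<in>carrier ?G. y \<otimes>\<^bsub>?G\<^esub> x = \<one>\<^bsub>?G\<^esub>" if x: "x \<in> carrier ?G" for x
  proof -
    obtain w where w: "w \<in> gwords X" "x = ?c w" using x carr by auto
    have "?c (winv w) \<otimes>\<^bsub>?G\<^esub> ?c w = ?c []"
      using w word_eq_winv[OF w(1)] equiv_class_eq[OF equiv_word_eq]
      by (simp add: mult_presented_group)
    then show ?thesis using w word_eq_winv[OF w(1)] carr one by auto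
  qed
qed

end


section \<open>The virtual braid group and the stringy group\<close>

text \<open>Strands are numbered \<open>1, \<dots>, n\<close>. In both groups \<open>v i\<close> is the generator attached to the
  adjacent transposition of \<open>i\<close> and \<open>i + 1\<close>.\<close>

definition sym_rels :: "(nat \<Rightarrow> 'g) \<Rightarrow> nat \<Rightarrow> ('g gword \<times> 'g gword) set" where
  "sym_rels v n =
     {(gen (v i) @ gen (v (i+1)) @ gen (v i), gen (v (i+1)) @ gen (v i) @ gen (v (i+1))) | i.
        i \<in> {1..<n} \<and> i + 1 \<in> {1..<n}}
   \<union> {(gen (v i) @ gen (v j), gen (v j) @ gen (v i)) | i j.
        i \<in> {1..<n} \<and> j \<in> {1..<n} \<and> \<bar>int i - int j\<bar> > 1}
   \<union> {(gen (v i) @ gen (v i), []) | i. i \<in> {1..<n}}"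

datatype vb_gen = Sigma nat | VBv nat

definition VB_gens :: "nat \<Rightarrow> vb_gen set" where
  "VB_gens n = Sigma ` {1..<n} \<union> VBv ` {1..<n}"

definition VB_rels :: "nat \<Rightarrow> (vb_gen gword \<times> vb_gen gword) set" where
  "VB_rels n =
     {(gen (Sigma i) @ gen (Sigma (i+1)) @ gen (Sigma i),
       gen (Sigma (i+1)) @ gen (Sigma i) @ gen (Sigma (i+1))) | i.
        i \<in> {1..<n} \<and> i + 1 \<in> {1..<n}}
   \<union> {(gen (Sigma i) @ gen (Sigma j), gen (Sigma j) @ gen (Sigma i)) | i j.
        i \<in> {1..<n} \<and> j \<in> {1..<n} \<and> \<bar>int i - int j\<bar> > 1}
   \<union> sym_rels VBv n
   \<union> {(gen (VBv i) @ gen (Sigma (i+1)) @ gen (VBv i),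
       gen (VBv (i+1)) @ gen (Sigma i) @ gen (VBv (i+1))) | i.
        i \<in> {1..<n} \<and> i + 1 \<in> {1..<n}}
   \<union> {(gen (Sigma i) @ gen (VBv j), gen (VBv j) @ gen (Sigma i)) | i j.
        i \<in> {1..<n} \<and> j \<in> {1..<n} \<and> \<bar>int i - int j\<bar> > 1}"

definition VB :: "nat \<Rightarrow> vb_gen gword set monoid" where
  "VB n = presented_group (VB_gens n) (VB_rels n)"

datatype vs_gen = Mu nat nat | VSv nat

definition VS_gens :: "nat \<Rightarrow> vs_gen set" where
  "VS_gens n = {Mu i j | i j. i \<in> {1..n} \<and> j \<in> {1..n} \<and> i \<noteq> j} \<union> VSv ` {1..<n}"

text \<open>\<open>adj_prod [k1, \<dots>, km]\<close> is the composition of functions \<open>s_k1 \<circ> \<dots> \<circ> s_km\<close> (rightmost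
  factor applied first), with \<open>s_k\<close> the transposition of \<open>k\<close> and \<open>k + 1\<close>.\<close>

definition adj_prod :: "nat list \<Rightarrow> nat \<Rightarrow> nat" where
  "adj_prod ks = foldr (\<lambda>k \<tau>. transpose k (k+1) \<circ> \<tau>) ks id"

definition perm_word :: "nat list \<Rightarrow> vs_gen gword" where
  "perm_word ks = concat (map (\<lambda>k. gen (VSv k)) ks)"

text \<open>The conjugation relation is imposed for every permutation \<open>\<tau>\<close> and every expression of \<open>\<tau>\<close>
  as a product of adjacent transpositions. By the relations among the \<open>v i\<close>, two expressions of
  the same \<open>\<tau>\<close> give equal elements, so no particular expression has to be chosen.\<close>

definition VS_rels :: "nat \<Rightarrow> (vs_gen gword \<times> vs_gen gword) set" where
  "VS_rels n =
     sym_rels VSv n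
   \<union> {(perm_word ks @ gen (Mu i j) @ winv (perm_word ks), gen (Mu (\<tau> i) (\<tau> j))) | \<tau> ks i j.
        \<tau> permutes {1..n} \<and> set ks \<subseteq> {1..<n} \<and> \<tau> = adj_prod ks \<and>
        i \<in> {1..n} \<and> j \<in> {1..n} \<and> i \<noteq> j}
   \<union> (if n \<ge> 3 then
        {(gen (Mu 1 2) @ gen (Mu 1 3) @ gen (Mu 2 3), gen (Mu 2 3) @ gen (Mu 1 3) @ gen (Mu 1 2))}
      else {})
   \<union> (if n \<ge> 4 then
        {(gen (Mu 1 2) @ gen (Mu 3 4), gen (Mu 3 4) @ gen (Mu 1 2))}
      else {})"

definition VS :: "nat \<Rightarrow> vs_gen gword set monoid" where
  "VS n = presented_group (VS_gens n) (VS_rels n)"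

lemma gwords_simps:
  "[] \<in> gwords X"
  "u @ v \<in> gwords X \<longleftrightarrow> u \<in> gwords X \<and> v \<in> gwords X"
  "gen x \<in> gwords X \<longleftrightarrow> x \<in> X"
  by (auto simp: gwords_def gen_def)

lemma sym_rels_words:
  assumes "\<And>i. i \<in> {1..<n} \<Longrightarrow> v i \<in> X"
  shows "sym_rels v n \<subseteq> gwords X \<times> gwords X"
  unfolding sym_rels_def using assms
  by (intro Un_least subsetI; elim CollectE exE conjE)
    (simp_all only: gwords_simps mem_Times_iff fst_conv snd_conv simp_thms)

lemma VB_rels_words: "VB_rels n \<subseteq> gwords (VB_gens n) \<times> gwords (VB_gens n)"
proof -
  have g: "Sigma i \<in> VB_gens n" "VBv i \<in> VB_gens n" if "i \<in> {1..<n}" for i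
    using that by (auto simp: VB_gens_def)
  show ?thesis
    unfolding VB_rels_def using g
    by (intro Un_least sym_rels_words subsetI; (elim CollectE exE conjE)?)
      (simp_all only: gwords_simps mem_Times_iff fst_conv snd_conv simp_thms)
qed

lemma group_VB: "group (VB n)"
  unfolding VB_def by (rule group_presented_group[OF VB_rels_words])

lemma perm_word_words: "set ks \<subseteq> {1..<n} \<Longrightarrow> perm_word ks \<in> gwords (VS_gens n)"
  by (induction ks) (auto simp: perm_word_def gwords_def gen_def VS_gens_def)

lemma VS_rels_words: "VS_rels n \<subseteq> gwords (VS_gens n) \<times> gwords (VS_gens n)"
proof -
  have inv: "winv w \<in> gwords X" if "w \<in> gwords X" for w :: "vs_gen gword" and X
    using that by (auto simp: winv_def gwords_def)
  have mu: "Mu (\<tau> i) (\<tau> j) \<in> VS_gens n"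
    if "\<tau> permutes {1..n}" "i \<in> {1..n}" "j \<in> {1..n}" "i \<noteq> j" for \<tau> i j
  proof -
    have "\<tau> i \<in> {1..n}" "\<tau> j \<in> {1..n}" "\<tau> i \<noteq> \<tau> j"
      using that permutes_in_image[OF that(1)] permutes_inj[OF that(1)] by (auto dest: injD)
    then show ?thesis by (auto simp: VS_gens_def)
  qed
  have mu': "Mu i j \<in> VS_gens n \<longleftrightarrow> i \<in> {1..n} \<and> j \<in> {1..n} \<and> i \<noteq> j"
    and v': "VSv i \<in> VS_gens n \<longleftrightarrow> i \<in> {1..<n}" for i j
    by (auto simp: VS_gens_def)
  have syms: "sym_rels VSv n \<subseteq> gwords (VS_gens n) \<times> gwords (VS_gens n)"
    by (rule sym_rels_words) (simp only: v')
  have conj: "(perm_word ks @ gen (Mu i j) @ winv (perm_word ks), gen (Mu (\<tau> i) (\<tau> j)))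
      \<in> gwords (VS_gens n) \<times> gwords (VS_gens n)"
    if "\<tau> permutes {1..n}" "set ks \<subseteq> {1..<n}" "i \<in> {1..n}" "j \<in> {1..n}" "i \<noteq> j" for \<tau> ks i j
  proof -
    have "perm_word ks \<in> gwords (VS_gens n)" using that by (intro perm_word_words)
    moreover have "Mu (\<tau> i) (\<tau> j) \<in> VS_gens n" using that by (intro mu)
    moreover have "Mu i j \<in> VS_gens n" using that by (simp only: mu') simp
    ultimately show ?thesis by (simp only: gwords_simps mem_Times_iff fst_conv snd_conv inv simp_thms)
  qed
  have "{(perm_word ks @ gen (Mu i j) @ winv (perm_word ks), gen (Mu (\<tau> i) (\<tau> j))) | \<tau> ks i j.
        \<tau> permutes {1..n} \<and> set ks \<subseteq> {1..<n} \<and> \<tau> = adj_prod ks \<and>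
        i \<in> {1..n} \<and> j \<in> {1..n} \<and> i \<noteq> j} \<subseteq> gwords (VS_gens n) \<times> gwords (VS_gens n)"
    using conj by blast
  moreover have "(if n \<ge> 3 then
        {(gen (Mu 1 2) @ gen (Mu 1 3) @ gen (Mu 2 3), gen (Mu 2 3) @ gen (Mu 1 3) @ gen (Mu 1 2))}
      else {}) \<subseteq> gwords (VS_gens n) \<times> gwords (VS_gens n)"
    by (simp add: gwords_simps mu')
  moreover have "(if n \<ge> 4 then
        {(gen (Mu 1 2) @ gen (Mu 3 4), gen (Mu 3 4) @ gen (Mu 1 2))}
      else {}) \<subseteq> gwords (VS_gens n) \<times> gwords (VS_gens n)"
    by (simp add: gwords_simps mu')
  ultimately show ?thesis
    unfolding VS_rels_def by (intro Un_least syms)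
qed

lemma group_VS: "group (VS n)"
  unfolding VS_def by (rule group_presented_group[OF VS_rels_words])

end

theory Submission
  imports Defs
begin

text \<open>The isomorphism sends \<open>\<sigma>\<^sub>i\<close> to \<open>\<mu>\<^bsub>i,i+1\<^esub> v\<^sub>i\<close>. Conversely \<open>\<mu>\<^bsub>i,i+1\<^esub>\<close> and \<open>\<mu>\<^bsub>i+1,i\<^esub>\<close> go to
  \<open>\<sigma>\<^sub>i v\<^sub>i\<close> and \<open>v\<^sub>i \<sigma>\<^sub>i\<close>, and for distant indices \<open>\<mu>\<^sub>i\<^sub>j\<close> goes to an explicit conjugate, obtained by
  moving the larger index up one step at a time. Checking case by case that conjugation by \<open>v\<^sub>k\<close>
  permutes these elements as \<open>s\<^sub>k\<close> permutes the indices avoids any appeal to the Coxeter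
  presentation of the symmetric group. In the other direction, conjugation by the \<open>v\<^sub>k\<close> spreads the
  two relations on small indices to all the indices needed for the braid relations.\<close>

section \<open>Universal property of presented groups\<close>

text \<open>The fold nests products to the right and ends in the unit, so evaluating a relator
  gives, up to that unit, exactly the right-nested products in which the locales below state their
  axioms.\<close>

definition word_eval :: "('a, 'b) monoid_scheme \<Rightarrow> ('g \<Rightarrow> 'a) \<Rightarrow> 'g gword \<Rightarrow> 'a" where
  "word_eval G h w =
     foldr (\<lambda>(x, e) y. (if e then h x else inv\<^bsub>G\<^esub> h x) \<otimes>\<^bsub>G\<^esub> y) w \<one>\<^bsub>G\<^esub>"

lemma word_eval_Nil [simp]: "word_eval G h [] = \<one>\<^bsub>G\<^esub>"
  by (simp add: word_eval_def)

lemma word_eval_Cons: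
  "word_eval G h ((x, e) # w) = (if e then h x else inv\<^bsub>G\<^esub> h x) \<otimes>\<^bsub>G\<^esub> word_eval G h w"
  by (simp add: word_eval_def)

context group
begin

lemma word_eval_closed:
  assumes "h ` X \<subseteq> carrier G" "w \<in> gwords X"
  shows "word_eval G h w \<in> carrier G"
  using assms(2) by (induction w) (use assms(1) in \<open>auto simp: gwords_def word_eval_Cons\<close>)

lemma word_eval_append:
  assumes "h ` X \<subseteq> carrier G" "u \<in> gwords X" "w \<in> gwords X"
  shows "word_eval G h (u @ w) = word_eval G h u \<otimes> word_eval G h w"
  using assms(2)
proof (induction u)
  case Nil
  then show ?case using word_eval_closed[OF assms(1,3)] by simp
next
  case (Cons a u)
  obtain x e where a: "a = (x, e)" by (cases a)
  have "x \<in> X" and u: "u \<in> gwords X" using Cons.prems by (auto simp: gwords_def a)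
  then have "h x \<in> carrier G" using assms(1) by auto
  then show ?case
    using Cons.IH[OF u] word_eval_closed[OF assms(1) u] word_eval_closed[OF assms(1,3)]
    by (simp add: a word_eval_Cons m_assoc)
qed

lemma word_eval_gen: "h x \<in> carrier G \<Longrightarrow> word_eval G h (gen x) = h x"
  by (simp add: gen_def word_eval_Cons)

lemma word_eval_word_eq:
  assumes h: "h ` X \<subseteq> carrier G" and R: "R \<subseteq> gwords X \<times> gwords X"
    and rels: "\<And>r s. (r, s) \<in> R \<Longrightarrow> word_eval G h r = word_eval G h s"
    and "(u, w) \<in> word_eq X R"
  shows "word_eval G h u = word_eval G h w"
  using assms(4)
proof induction
  case (cancel x u v e)
  have "h x \<in> carrier G" using cancel h by auto
  then have "word_eval G h [(x, e), (x, \<not> e)] = \<one>"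
    by (simp add: word_eval_Cons)
  moreover have "[(x, e), (x, \<not> e)] \<in> gwords X" using cancel by (simp add: gwords_def)
  ultimately show ?case using cancel word_eval_closed[OF h]
    by (simp only: word_eval_append[OF h] gwords_simps) simp
next
  case (rel r s u v)
  then have "r \<in> gwords X" "s \<in> gwords X" using R by auto
  then show ?case using rel rels[OF rel(1)]
    by (simp only: word_eval_append[OF h] gwords_simps simp_thms)
qed auto

text \<open>Von Dyck's theorem. Evaluation is constant on the classes of \<open>word_eq\<close>,
  because cancellation holds in every group and the relators hold by assumption; so it descends to
  the quotient.\<close>

lemma presented_group_hom_exists:
  assumes h: "h ` X \<subseteq> carrier G" and R: "R \<subseteq> gwords X \<times> gwords X"
    and rels: "\<And>r s. (r, s) \<in> R \<Longrightarrow> word_eval G h r = word_eval G h s"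
  obtains F where "F \<in> hom (presented_group X R) G"
    and "\<And>w. w \<in> gwords X \<Longrightarrow> F (word_eq X R `` {w}) = word_eval G h w"
proof
  \<comment> \<open>The common value of all representatives of the class; uniqueness is
    \<open>word_eval_word_eq\<close>.\<close>
  let ?F = "\<lambda>A. THE y. \<exists>w\<in>A. y = word_eval G h w"
  show F: "?F (word_eq X R `` {w}) = word_eval G h w" if "w \<in> gwords X" for w
  proof (rule the_equality)
    show "\<exists>w'\<in>word_eq X R `` {w}. word_eval G h w = word_eval G h w'"
      using that by (auto intro: word_eq.refl)
    show "y = word_eval G h w" if "\<exists>w'\<in>word_eq X R `` {w}. y = word_eval G h w'" for y
      using that word_eval_word_eq[OF h R rels] by fastforce
  qed
  have carr: "carrier (presented_group X R) = (\<lambda>u. word_eq X R `` {u}) ` gwords X"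
    by (auto simp: presented_group_def quotient_def)
  show "?F \<in> hom (presented_group X R) G"
  proof (rule homI)
    show "?F x \<in> carrier G" if "x \<in> carrier (presented_group X R)" for x
      using that F word_eval_closed[OF h] by (auto simp: carr)
    show "?F (x \<otimes>\<^bsub>presented_group X R\<^esub> y) = ?F x \<otimes> ?F y"
      if "x \<in> carrier (presented_group X R)" "y \<in> carrier (presented_group X R)" for x y
      using that F word_eval_append[OF h]
      by (auto simp: carr mult_presented_group[OF R] gwords_simps)
  qed
qed

end

section \<open>Canonical generators of a presented group, and homomorphisms determined by
  them\<close>

definition pgen :: "'g set \<Rightarrow> ('g gword \<times> 'g gword) set \<Rightarrow> 'g \<Rightarrow> 'g gword set" where
  "pgen X R x = word_eq X R `` {gen x}"

context
  fixes X :: "'g set" and R :: "('g gword \<times> 'g gword) set"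
  assumes R: "R \<subseteq> gwords X \<times> gwords X"
begin

interpretation P: group "presented_group X R"
  by (rule group_presented_group[OF R])

lemma carrier_presented_group:
  "carrier (presented_group X R) = (\<lambda>u. word_eq X R `` {u}) ` gwords X"
  by (auto simp: presented_group_def quotient_def)

lemma pgen_closed: "pgen X R ` X \<subseteq> carrier (presented_group X R)"
  by (auto simp: carrier_presented_group pgen_def gwords_simps)

text \<open>Evaluation at the canonical generators is the quotient map. Hence the relators hold in
  the presented group, and every element is a product of canonical generators and their
  inverses.\<close>

lemma word_eval_pgen:
  assumes "w \<in> gwords X"
  shows "word_eval (presented_group X R) (pgen X R) w = word_eq X R `` {w}"
  using assms
proof (induction w)
  case Nil
  then show ?case by (simp add: presented_group_def)
next
  case (Cons a w)
  obtain x e where a: "a = (x, e)" by (cases a)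
  have x: "x \<in> X" and w: "w \<in> gwords X" using Cons.prems by (auto simp: gwords_def a)
  have single: "[(x, b)] \<in> gwords X" for b using x by (simp add: gwords_def)
  have "word_eq X R `` {[(x, False)]} = inv\<^bsub>presented_group X R\<^esub> pgen X R x"
  proof (rule P.inv_equality[symmetric])
    have "([(x, False), (x, True)], []) \<in> word_eq X R"
      using word_eq.cancel[OF x, of "[]" "[]" False R] by (simp add: gwords_simps)
    then show "word_eq X R `` {[(x, False)]} \<otimes>\<^bsub>presented_group X R\<^esub> pgen X R x
        = \<one>\<^bsub>presented_group X R\<^esub>"
      using single equiv_class_eq[OF equiv_word_eq[OF R]]
      by (simp add: pgen_def gen_def mult_presented_group[OF R]) (simp add: presented_group_def)
  qed (use single pgen_closed x in \<open>auto simp: carrier_presented_group\<close>)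
  then have "(if e then pgen X R x else inv\<^bsub>presented_group X R\<^esub> pgen X R x)
      = word_eq X R `` {[(x, e)]}"
    by (simp add: pgen_def gen_def)
  then show ?case
    using single w Cons.IH[OF w] by (simp add: a word_eval_Cons mult_presented_group[OF R])
qed

lemma word_eval_pgen_rel:
  assumes "(r, s) \<in> R"
  shows "word_eval (presented_group X R) (pgen X R) r = word_eval (presented_group X R) (pgen X R) s"
proof -
  have rs: "r \<in> gwords X" "s \<in> gwords X" using assms R by auto
  have "(r, s) \<in> word_eq X R"
    using word_eq.rel[OF assms, of "[]" X "[]"] by (simp add: gwords_simps)
  then have "word_eq X R `` {r} = word_eq X R `` {s}"
    by (rule equiv_class_eq[OF equiv_word_eq[OF R]])
  then show ?thesis using rs by (simp add: word_eval_pgen)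
qed

lemma presented_group_hom_extend:
  assumes H: "group H" and h: "h ` X \<subseteq> carrier H"
    and rels: "\<And>r s. (r, s) \<in> R \<Longrightarrow> word_eval H h r = word_eval H h s"
  obtains F where "F \<in> hom (presented_group X R) H" "\<And>x. x \<in> X \<Longrightarrow> F (pgen X R x) = h x"
proof -
  interpret H: group H by (rule H)
  obtain F where F: "F \<in> hom (presented_group X R) H"
    "\<And>w. w \<in> gwords X \<Longrightarrow> F (word_eq X R `` {w}) = word_eval H h w"
    using H.presented_group_hom_exists[OF h R rels] by metis
  show ?thesis
  proof (rule that[OF F(1)])
    show "F (pgen X R x) = h x" if "x \<in> X" for x
      using that F(2) h by (auto simp: pgen_def gwords_simps H.word_eval_gen)
  qed
qed

text \<open>By \<open>word_eval_pgen\<close> an endomorphism is determined on the generators.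
  Applied to both composites of two homomorphisms, this reduces the proof that they are mutually
  inverse to a check on generators.\<close>

lemma presented_group_hom_id:
  assumes F: "F \<in> hom (presented_group X R) (presented_group X R)"
    and gens: "\<And>x. x \<in> X \<Longrightarrow> F (pgen X R x) = pgen X R x"
    and "a \<in> carrier (presented_group X R)"
  shows "F a = a"
proof -
  interpret F: group_hom "presented_group X R" "presented_group X R" F
    by (unfold_locales) (rule F)
  have "F (word_eval (presented_group X R) (pgen X R) w) = word_eval (presented_group X R) (pgen X R) w"
    if "w \<in> gwords X" for w
    using that
  proof (induction w)
    case (Cons a w)
    obtain x e where a: "a = (x, e)" by (cases a)
    have x: "x \<in> X" and w: "w \<in> gwords X" using Cons.prems by (auto simp: gwords_def a)
    then have "pgen X R x \<in> carrier (presented_group X R)" using pgen_closed by auto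
    then show ?case
      using P.word_eval_closed[OF pgen_closed w] gens[OF x] Cons.IH[OF w]
      by (simp add: a word_eval_Cons)
  qed simp
  then show ?thesis using assms(3) by (auto simp: carrier_presented_group word_eval_pgen)
qed

end

lemma iso_by_inverse_homs:
  assumes "F \<in> hom G H" "K \<in> hom H G"
    and "\<And>x. x \<in> carrier G \<Longrightarrow> K (F x) = x" "\<And>y. y \<in> carrier H \<Longrightarrow> F (K y) = y"
  shows "G \<cong> H"
proof -
  have "bij_betw F (carrier G) (carrier H)"
    by (rule bij_betwI[where g = K]) (use assms in \<open>auto simp: hom_def\<close>)
  then show ?thesis using assms(1) by (auto simp: is_iso_def iso_def)
qed

section \<open>Elements satisfying the relations in an arbitrary group\<close>

locale sym_family = group G for G (structure) +
  fixes n :: nat and v :: "nat \<Rightarrow> 'a"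
  assumes v_closed [simp]: "k \<in> {1..<n} \<Longrightarrow> v k \<in> carrier G"
    and v_braid: "\<lbrakk>k \<in> {1..<n}; k + 1 \<in> {1..<n}\<rbrakk> \<Longrightarrow>
      v k \<otimes> (v (k+1) \<otimes> v k) = v (k+1) \<otimes> (v k \<otimes> v (k+1))"
    and v_comm: "\<lbrakk>k \<in> {1..<n}; l \<in> {1..<n}; \<bar>int k - int l\<bar> > 1\<rbrakk> \<Longrightarrow> v k \<otimes> v l = v l \<otimes> v k"
    and v_sq: "k \<in> {1..<n} \<Longrightarrow> v k \<otimes> v k = \<one>"
begin

text \<open>Conjugation by \<open>v k\<close>; no inverse is written because \<open>v k\<close> is
  an involution.\<close>

definition cj :: "nat \<Rightarrow> 'a \<Rightarrow> 'a" where
  "cj k x = v k \<otimes> (x \<otimes> v k)"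

lemma v_inv: "k \<in> {1..<n} \<Longrightarrow> inv (v k) = v k"
  by (simp add: inv_equality v_sq)

lemma v_cancel: "\<lbrakk>k \<in> {1..<n}; x \<in> carrier G\<rbrakk> \<Longrightarrow> v k \<otimes> (v k \<otimes> x) = x"
  by (simp flip: m_assoc add: v_sq)

lemma cj_closed [simp]: "\<lbrakk>k \<in> {1..<n}; x \<in> carrier G\<rbrakk> \<Longrightarrow> cj k x \<in> carrier G"
  by (simp add: cj_def)

lemma cj_mult:
  "\<lbrakk>k \<in> {1..<n}; x \<in> carrier G; y \<in> carrier G\<rbrakk> \<Longrightarrow> cj k (x \<otimes> y) = cj k x \<otimes> cj k y"
  by (simp add: cj_def m_assoc v_cancel)

lemma cj_cj: "\<lbrakk>k \<in> {1..<n}; x \<in> carrier G\<rbrakk> \<Longrightarrow> cj k (cj k x) = x"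
  by (simp add: cj_def m_assoc v_cancel v_sq)

lemma cj_v: "k \<in> {1..<n} \<Longrightarrow> cj k x = y \<Longrightarrow> x \<in> carrier G \<Longrightarrow> v k \<otimes> x = y \<otimes> v k"
  by (auto simp: cj_def m_assoc v_sq)

lemma cj_fixed_iff:
  "\<lbrakk>k \<in> {1..<n}; x \<in> carrier G\<rbrakk> \<Longrightarrow> cj k x = x \<longleftrightarrow> v k \<otimes> x = x \<otimes> v k"
  by (metis cj_def cj_v m_assoc m_closed v_cancel v_closed v_sq r_one)

lemma cj_commute:
  assumes "k \<in> {1..<n}" "l \<in> {1..<n}" "\<bar>int k - int l\<bar> > 1" "x \<in> carrier G"
  shows "cj k (cj l x) = cj l (cj k x)"
proof -
  have "cj k (cj l x) = (v k \<otimes> v l) \<otimes> x \<otimes> (v l \<otimes> v k)"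
    using assms by (simp add: cj_def m_assoc)
  also have "\<dots> = (v l \<otimes> v k) \<otimes> x \<otimes> (v k \<otimes> v l)"
    using v_comm[OF assms(1-3)] by simp
  also have "\<dots> = cj l (cj k x)"
    using assms by (simp add: cj_def m_assoc)
  finally show ?thesis .
qed

text \<open>The outer factors collect to \<open>v k\<close>, \<open>v (k+1)\<close>,
  \<open>v k\<close> on the left of \<open>x\<close>. This word is a palindrome, so the same product
  stands on the right and the braid relation applies to both.\<close>

lemma cj_braid:
  assumes "k \<in> {1..<n}" "k + 1 \<in> {1..<n}" "x \<in> carrier G"
  shows "cj k (cj (k+1) (cj k x)) = cj (k+1) (cj k (cj (k+1) x))"
proof -
  have "cj k (cj (k+1) (cj k x)) = (v k \<otimes> (v (k+1) \<otimes> v k)) \<otimes> x \<otimes> (v k \<otimes> (v (k+1) \<otimes> v k))"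
    using assms by (simp add: cj_def m_assoc)
  also have "\<dots> = cj (k+1) (cj k (cj (k+1) x))"
    unfolding v_braid[OF assms(1,2)] using assms by (simp add: cj_def m_assoc)
  finally show ?thesis .
qed

text \<open>\<open>push b i d\<close> is the element attached to the indices \<open>i\<close> and
  \<open>i + d + 1\<close>, so \<open>d\<close> is their distance minus one. It starts from
  \<open>b i\<close> at the pair \<open>i\<close>, \<open>i + 1\<close>; each conjugation moves the
  larger index from \<open>i + d + 1\<close> to \<open>i + d + 2\<close>.\<close>

primrec push :: "(nat \<Rightarrow> 'a) \<Rightarrow> nat \<Rightarrow> nat \<Rightarrow> 'a" where
  "push b i 0 = b i"
| "push b i (Suc d) = cj (i + d + 1) (push b i d)"

end

text \<open>The properties shared by the families \<open>s i\<close> times \<open>v i\<close> and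
  \<open>v i\<close> times \<open>s i\<close>, so that increasing and decreasing index pairs are
  handled by one argument. Axiom \<open>b_shift\<close> moves the pair \<open>i\<close>,
  \<open>i + 1\<close> first to \<open>i\<close>, \<open>i + 2\<close> and then to
  \<open>i + 1\<close>, \<open>i + 2\<close>. Nothing is assumed on \<open>cj i (b i)\<close>, since
  that conjugation exchanges the two families.\<close>

locale adjacent_family = sym_family +
  fixes b :: "nat \<Rightarrow> 'a"
  assumes b_closed [simp]: "i \<in> {1..<n} \<Longrightarrow> b i \<in> carrier G"
    and b_far: "\<lbrakk>k \<in> {1..<n}; i \<in> {1..<n}; \<bar>int k - int i\<bar> > 1\<rbrakk> \<Longrightarrow> cj k (b i) = b i"
    and b_shift: "\<lbrakk>i \<in> {1..<n}; i + 1 \<in> {1..<n}\<rbrakk> \<Longrightarrow> cj i (cj (i+1) (b i)) = b (i+1)"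
begin

lemma push_closed [simp]: "\<lbrakk>1 \<le> i; i + d + 1 \<le> n\<rbrakk> \<Longrightarrow> push b i d \<in> carrier G"
  by (induction d) auto

lemma push_outside:
  assumes "1 \<le> i" "i + d + 1 \<le> n" "k \<in> {1..<n}" "i + d + 1 < k \<or> k + 1 < i"
  shows "cj k (push b i d) = push b i d"
  using assms
proof (induction d)
  case 0
  then show ?case by (auto intro: b_far)
next
  case (Suc d)
  have "cj k (push b i (Suc d)) = cj (i + d + 1) (cj k (push b i d))"
    using Suc.prems by (simp only: push.simps) (rule cj_commute, auto)
  then show ?case using Suc by auto
qed

text \<open>The case \<open>d = 0\<close> is \<open>b_shift\<close>. Every later conjugation has
  index at least \<open>i + 2\<close>, so \<open>cj i\<close> passes through it.\<close>

lemma push_left: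
  assumes "1 \<le> i" "i + d + 2 \<le> n"
  shows "cj i (push b i (Suc d)) = push b (i + 1) d"
  using assms
proof (induction d)
  case 0
  then show ?case using b_shift[of i] by simp
next
  case (Suc d)
  have "cj i (push b i (Suc (Suc d))) = cj (i + Suc d + 1) (cj i (push b i (Suc d)))"
    using Suc.prems by (subst push.simps) (rule cj_commute, auto)
  also have "\<dots> = push b (i + 1) (Suc d)" using Suc by simp
  finally show ?case .
qed

text \<open>Conjugation by \<open>v k\<close> passes through the outer conjugations until those with
  indices \<open>k + 1\<close> and \<open>k\<close> are outermost. There the braid relation trades
  the two outer \<open>k\<close> for two \<open>k + 1\<close>, and the innermost of these acts
  trivially by \<open>push_outside\<close>.\<close>

lemma push_between:
  assumes "1 \<le> i" "i + d + 1 \<le> n" "i < k" "k < i + d"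
  shows "cj k (push b i d) = push b i d"
  using assms
proof (induction d)
  case (Suc d)
  show ?case
  proof (cases "k = i + d")
    case True
    then obtain e where d: "d = Suc e" using Suc.prems by (cases d) auto
    have k: "k = i + e + 1" and kn: "k \<in> {1..<n}" "k + 1 \<in> {1..<n}"
      using True Suc.prems by (auto simp: d)
    have cl: "push b i e \<in> carrier G" using Suc.prems d by simp
    have "cj k (push b i (Suc d)) = cj k (cj (k + 1) (cj k (push b i e)))"
      by (simp add: d k)
    also have "\<dots> = cj (k + 1) (cj k (cj (k + 1) (push b i e)))"
      by (rule cj_braid[OF kn cl])
    also have "cj (k + 1) (push b i e) = push b i e"
      using Suc.prems kn by (intro push_outside) (auto simp: k d)
    also have "cj (k + 1) (cj k (push b i e)) = push b i (Suc d)"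
      by (simp add: d k)
    finally show ?thesis .
  next
    case False
    have "cj k (push b i (Suc d)) = cj (i + d + 1) (cj k (push b i d))"
      using Suc.prems False by (simp only: push.simps) (rule cj_commute, auto)
    then show ?thesis using Suc False by auto
  qed
qed simp

text \<open>The excluded case is the swap of an adjacent pair, the only one in which the
  transposition reverses the order of \<open>i\<close> and \<open>j\<close>.\<close>

lemma push_equivariant:
  assumes "1 \<le> i" "i < j" "j \<le> n" "k \<in> {1..<n}" "\<not> (k = i \<and> j = i + 1)"
  defines "i' \<equiv> transpose k (k+1) i" and "j' \<equiv> transpose k (k+1) j"
  shows "i' < j' \<and> cj k (push b i (j - Suc i)) = push b i' (j' - Suc i')"
proof -
  obtain d where j: "j = i + d + 1"
    using assms(2) by (metis less_imp_add_positive add.assoc Suc_eq_plus1 gr0_implies_Suc)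
  \<comment> \<open>In order: the transposition lies below both indices, lowers \<open>i\<close>,
    raises \<open>i\<close>, lies strictly between, lowers \<open>j\<close>, raises
    \<open>j\<close>, lies above both. Lowering \<open>i\<close> inverts \<open>push_left\<close>,
    lowering \<open>j\<close> undoes the last conjugation, and raising \<open>j\<close> is the
    recursion of \<open>push\<close>.\<close>
  consider "k + 1 < i" | "k + 1 = i" | "k = i" "k < i + d" | "i < k" "k < i + d" | "i < k" "k = i + d"
    | "k = i + d + 1" | "i + d + 1 < k"
    using assms by (fastforce simp: j)
  then show ?thesis
  proof cases
    case 1
    then show ?thesis using assms push_outside[of i d k] by (auto simp: j transpose_def)
  next
    case 2
    then have i': "i' = k" "j' = j" using assms by (auto simp: transpose_def)
    have "cj k (push b k (Suc d)) = push b i d" using push_left[of k d] assms 2 by (simp add: j)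
    then have "cj k (push b i d) = push b k (Suc d)"
      using cj_cj[OF assms(4), of "push b k (Suc d)"] assms 2
      by (metis Suc_eq_plus1 add.commute add_Suc_right atLeastLessThan_iff j push_closed)
    then show ?thesis using i' 2 by (auto simp: j)
  next
    case 3
    then obtain e where "d = Suc e" by (cases d) auto
    then show ?thesis using 3 assms push_left[of i e] by (auto simp: j transpose_def)
  next
    case 4
    then show ?thesis using assms push_between[of i d k] by (auto simp: j transpose_def)
  next
    case 5
    then obtain e where "d = Suc e" by (cases d) auto
    then show ?thesis using 5 assms by (auto simp: j transpose_def cj_cj)
  next
    case 6
    then show ?thesis using assms by (auto simp: j transpose_def)
  next
    case 7
    then show ?thesis using assms push_outside[of i d k] by (auto simp: j transpose_def)
  qed
qed

end

locale vbraid_family = sym_family +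
  fixes s :: "nat \<Rightarrow> 'a"
  assumes s_closed [simp]: "i \<in> {1..<n} \<Longrightarrow> s i \<in> carrier G"
    and s_braid: "\<lbrakk>i \<in> {1..<n}; i + 1 \<in> {1..<n}\<rbrakk> \<Longrightarrow>
      s i \<otimes> (s (i+1) \<otimes> s i) = s (i+1) \<otimes> (s i \<otimes> s (i+1))"
    and s_comm: "\<lbrakk>i \<in> {1..<n}; j \<in> {1..<n}; \<bar>int i - int j\<bar> > 1\<rbrakk> \<Longrightarrow> s i \<otimes> s j = s j \<otimes> s i"
    and s_mixed: "\<lbrakk>i \<in> {1..<n}; i + 1 \<in> {1..<n}\<rbrakk> \<Longrightarrow>
      v i \<otimes> (s (i+1) \<otimes> v i) = v (i+1) \<otimes> (s i \<otimes> v (i+1))"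
    and s_v_comm: "\<lbrakk>i \<in> {1..<n}; j \<in> {1..<n}; \<bar>int i - int j\<bar> > 1\<rbrakk> \<Longrightarrow> s i \<otimes> v j = v j \<otimes> s i"

locale stringy_family = sym_family +
  fixes m :: "nat \<Rightarrow> nat \<Rightarrow> 'a"
  assumes mu_closed [simp]: "\<lbrakk>i \<in> {1..n}; j \<in> {1..n}; i \<noteq> j\<rbrakk> \<Longrightarrow> m i j \<in> carrier G"
    and m_equivariant: "\<lbrakk>k \<in> {1..<n}; i \<in> {1..n}; j \<in> {1..n}; i \<noteq> j\<rbrakk> \<Longrightarrow>
      cj k (m i j) = m (transpose k (k+1) i) (transpose k (k+1) j)"
    and m_yang_baxter: "n \<ge> 3 \<Longrightarrow> m 1 2 \<otimes> (m 1 3 \<otimes> m 2 3) = m 2 3 \<otimes> (m 1 3 \<otimes> m 1 2)"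
    and m_comm: "n \<ge> 4 \<Longrightarrow> m 1 2 \<otimes> m 3 4 = m 3 4 \<otimes> m 1 2"

section \<open>From virtual braids to stringy elements\<close>

context vbraid_family
begin

text \<open>In both branches the smaller index is the starting point of \<open>push\<close>; the
  order of the two indices decides which product is the base element.\<close>

definition sm :: "nat \<Rightarrow> nat \<Rightarrow> 'a" where
  "sm i j = (if i < j then push (\<lambda>i. s i \<otimes> v i) i (j - Suc i) else push (\<lambda>i. v i \<otimes> s i) j (i - Suc j))"

lemma cj_s_far: "\<lbrakk>k \<in> {1..<n}; i \<in> {1..<n}; \<bar>int k - int i\<bar> > 1\<rbrakk> \<Longrightarrow> cj k (s i) = s i"
  using s_v_comm[of i k] by (simp add: cj_fixed_iff abs_minus_commute)

lemma cj_v_far: "\<lbrakk>k \<in> {1..<n}; i \<in> {1..<n}; \<bar>int k - int i\<bar> > 1\<rbrakk> \<Longrightarrow> cj k (v i) = v i"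
  using v_comm[of i k] by (simp add: cj_fixed_iff abs_minus_commute)

text \<open>The mixed relation says that \<open>s i\<close> conjugated by \<open>v (i+1)\<close>
  equals \<open>s (i+1)\<close> conjugated by \<open>v i\<close>. In \<open>cj_v_shift\<close> the
  braid relation of the \<open>v i\<close> plays the same part.\<close>

lemma cj_s_shift:
  assumes "i \<in> {1..<n}" "i + 1 \<in> {1..<n}"
  shows "cj i (cj (i+1) (s i)) = s (i+1)"
proof -
  have "cj (i+1) (s i) = cj i (s (i+1))" using s_mixed[OF assms] by (simp add: cj_def)
  then show ?thesis using assms by (simp add: cj_cj)
qed

lemma cj_v_shift:
  assumes "i \<in> {1..<n}" "i + 1 \<in> {1..<n}"
  shows "cj i (cj (i+1) (v i)) = v (i+1)"
proof -
  have "cj (i+1) (v i) = cj i (v (i+1))" using v_braid[OF assms] by (simp add: cj_def)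
  then show ?thesis using assms by (simp add: cj_cj)
qed

sublocale sv: adjacent_family G n v "\<lambda>i. s i \<otimes> v i"
  by unfold_locales (auto simp: cj_mult cj_s_far cj_v_far cj_s_shift[simplified] cj_v_shift[simplified])

sublocale vs: adjacent_family G n v "\<lambda>i. v i \<otimes> s i"
  by unfold_locales (auto simp: cj_mult cj_s_far cj_v_far cj_s_shift[simplified] cj_v_shift[simplified])

lemma sm_closed: "\<lbrakk>i \<in> {1..n}; j \<in> {1..n}; i \<noteq> j\<rbrakk> \<Longrightarrow> sm i j \<in> carrier G"
  by (auto simp: sm_def intro!: sv.push_closed vs.push_closed)

lemma sm_adjacent: "sm i (Suc i) = s i \<otimes> v i" "sm (Suc i) i = v i \<otimes> s i"
  by (simp_all add: sm_def)

text \<open>Swapping an adjacent pair exchanges the two base products because \<open>v k\<close>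
  squares to one. All other cases preserve the order of the indices and fall under
  \<open>push_equivariant\<close>.\<close>

lemma sm_equivariant:
  assumes "k \<in> {1..<n}" "i \<in> {1..n}" "j \<in> {1..n}" "i \<noteq> j"
  shows "cj k (sm i j) = sm (transpose k (k+1) i) (transpose k (k+1) j)"
proof -
  consider "k = i" "j = i + 1" | "k = j" "i = j + 1" | "i < j" "\<not> (k = i \<and> j = i + 1)"
    | "j < i" "\<not> (k = j \<and> i = j + 1)"
    using assms by linarith
  then show ?thesis
  proof cases
    case 1
    then show ?thesis using assms by (simp add: sm_adjacent cj_def m_assoc v_sq)
  next
    case 2
    then show ?thesis using assms by (simp add: sm_adjacent cj_def m_assoc v_cancel)
  next
    case 3
    then show ?thesis using assms sv.push_equivariant[of i j k] by (simp add: sm_def)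
  next
    case 4
    then show ?thesis using assms vs.push_equivariant[of j i k] by (auto simp: sm_def)
  qed
qed

lemma stringy_family_sm: "stringy_family G n v sm"
proof unfold_locales
  show "sm 1 2 \<otimes> (sm 1 3 \<otimes> sm 2 3) = sm 2 3 \<otimes> (sm 1 3 \<otimes> sm 1 2)" if n: "n \<ge> 3"
  proof -
    have r: "(1::nat) \<in> {1..<n}" "(2::nat) \<in> {1..<n}" using n by auto
    have cl: "v 1 \<in> carrier G" "v 2 \<in> carrier G" "s 1 \<in> carrier G" "s 2 \<in> carrier G"
      using r by auto
    have m12: "sm 1 2 = s 1 \<otimes> v 1" and m23: "sm 2 3 = s 2 \<otimes> v 2"
      using sm_adjacent(1)[of 1] sm_adjacent(1)[of 2] by (simp_all add: numeral_eq_Suc)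
    \<comment> \<open>Two expressions for the same element, one for each side of the Yang-Baxter
      relation: each makes two neighbouring \<open>v\<close> factors cancel.\<close>
    have m13: "sm 1 3 = cj 2 (s 1 \<otimes> v 1)" "sm 1 3 = cj 1 (s 2 \<otimes> v 2)"
      using sm_equivariant[OF r(2), of 1 2] sm_equivariant[OF r(1), of 2 3] n
      by (simp_all add: m12[symmetric] m23[symmetric] transpose_def del: One_nat_def)
    have S: "s 1 \<otimes> (s 2 \<otimes> s 1) = s 2 \<otimes> (s 1 \<otimes> s 2)"
      and V: "v 1 \<otimes> (v 2 \<otimes> v 1) = v 2 \<otimes> (v 1 \<otimes> v 2)"
      and M: "v 1 \<otimes> (s 2 \<otimes> v 1) = v 2 \<otimes> (s 1 \<otimes> v 2)"
      using s_braid[of 1] v_braid[of 1] s_mixed[of 1] r by (simp_all add: numeral_eq_Suc)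
    \<comment> \<open>\<open>M1\<close> and \<open>M2\<close> are forms of the mixed relation that
      move two \<open>v\<close> factors past one \<open>s\<close>. They turn the two sides into
      \<open>s 1 s 2 s 1\<close> times \<open>v 2 v 1 v 2\<close> and \<open>s 2 s 1 s 2\<close>
      times \<open>v 1 v 2 v 1\<close>, which agree by both braid relations.\<close>
    have M1: "v 2 \<otimes> (v 1 \<otimes> s 2) = s 1 \<otimes> (v 2 \<otimes> v 1)"
      using arg_cong[OF M, of "\<lambda>x. v 2 \<otimes> (x \<otimes> v 1)"] cl r
      by (simp add: m_assoc v_cancel v_sq del: One_nat_def)
    have M2: "v 1 \<otimes> (v 2 \<otimes> s 1) = s 2 \<otimes> (v 1 \<otimes> v 2)"
    proof -
      have "v 1 \<otimes> (s 2 \<otimes> (v 1 \<otimes> v 2)) = v 2 \<otimes> s 1"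
        using arg_cong[OF M, of "\<lambda>x. x \<otimes> v 2"] cl r
        by (simp add: m_assoc v_cancel v_sq del: One_nat_def)
      show ?thesis
        unfolding \<open>v 1 \<otimes> (s 2 \<otimes> (v 1 \<otimes> v 2)) = v 2 \<otimes> s 1\<close>[symmetric]
        using cl r by (simp add: v_cancel del: One_nat_def)
    qed
    have "sm 1 2 \<otimes> (sm 1 3 \<otimes> sm 2 3) = s 1 \<otimes> s 2 \<otimes> (v 2 \<otimes> (v 1 \<otimes> s 2)) \<otimes> v 2"
      unfolding m12 m23 m13(2) using cl r
      by (simp add: cj_def m_assoc v_cancel del: One_nat_def)
    also have "\<dots> = (s 1 \<otimes> (s 2 \<otimes> s 1)) \<otimes> (v 2 \<otimes> (v 1 \<otimes> v 2))"
      unfolding M1 using cl by (simp add: m_assoc del: One_nat_def)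
    also have "\<dots> = s 2 \<otimes> s 1 \<otimes> (s 2 \<otimes> (v 1 \<otimes> v 2)) \<otimes> v 1"
      unfolding S V[symmetric] using cl by (simp add: m_assoc del: One_nat_def)
    also have "\<dots> = sm 2 3 \<otimes> (sm 1 3 \<otimes> sm 1 2)"
      unfolding M2[symmetric] m12 m23 m13(1) using cl r
      by (simp add: cj_def m_assoc v_cancel del: One_nat_def)
    finally show ?thesis .
  qed
  show "sm 1 2 \<otimes> sm 3 4 = sm 3 4 \<otimes> sm 1 2" if n: "n \<ge> 4"
  proof -
    have r: "(1::nat) \<in> {1..<n}" "(3::nat) \<in> {1..<n}" using n by auto
    have "sm 3 4 = s 3 \<otimes> v 3" "sm 1 2 = s 1 \<otimes> v 1"
      using sm_adjacent(1)[of 3] sm_adjacent(1)[of 1] by (simp_all add: numeral_eq_Suc)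
    moreover have "s 1 \<otimes> s 3 = s 3 \<otimes> s 1" "s 1 \<otimes> v 3 = v 3 \<otimes> s 1" "s 3 \<otimes> v 1 = v 1 \<otimes> s 3"
      "v 1 \<otimes> v 3 = v 3 \<otimes> v 1"
      using r by (auto intro!: s_comm s_v_comm v_comm)
    ultimately show ?thesis
      using r by (smt (verit) m_assoc m_closed s_closed v_closed)
  qed
qed (use sm_closed sm_equivariant in auto)

end

section \<open>From stringy elements to virtual braids\<close>

context stringy_family
begin

lemma m_equivariantD:
  assumes "k \<in> {1..<n}" "i \<in> {1..n}" "j \<in> {1..n}" "i \<noteq> j"
    "transpose k (k+1) i = i'" "transpose k (k+1) j = j'"
  shows "cj k (m i j) = m i' j'"
  using m_equivariant[OF assms(1-4)] assms(5,6) by simp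

definition yb :: "nat \<Rightarrow> nat \<Rightarrow> nat \<Rightarrow> bool" where
  "yb a b c \<longleftrightarrow> m a b \<otimes> (m a c \<otimes> m b c) = m b c \<otimes> (m a c \<otimes> m a b)"

lemma yb_transpose:
  assumes "yb a b c" "k \<in> {1..<n}" "a \<in> {1..n}" "b \<in> {1..n}" "c \<in> {1..n}" "distinct [a, b, c]"
    "transpose k (k+1) a = a'" "transpose k (k+1) b = b'" "transpose k (k+1) c = c'"
  shows "yb a' b' c'"
proof -
  have "cj k (m a b \<otimes> (m a c \<otimes> m b c)) = cj k (m b c \<otimes> (m a c \<otimes> m a b))"
    using assms by (simp add: yb_def)
  then show ?thesis using assms(2-)
    by (simp add: cj_mult m_equivariantD yb_def)
qed

text \<open>The triple is shifted up by one, largest index first, so that each transposition moves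
  only one of the three indices.\<close>

lemma yb_adjacent: "\<lbrakk>1 \<le> i; i + 2 \<le> n\<rbrakk> \<Longrightarrow> yb i (i + 1) (i + 2)"
proof (induction i rule: dec_induct)
  case base
  then show ?case using m_yang_baxter by (simp add: yb_def numeral_eq_Suc)
next
  case (step i)
  have "yb i (i+1) (i+2)" using step by simp
  then have "yb i (i+1) (i+3)"
    by (rule yb_transpose[where k = "i+2"]) (use step in \<open>auto simp: transpose_def\<close>)
  then have "yb i (i+2) (i+3)"
    by (rule yb_transpose[where k = "i+1"]) (use step in \<open>auto simp: transpose_def\<close>)
  then have "yb (i+1) (i+2) (i+3)"
    by (rule yb_transpose[where k = "i"]) (use step in \<open>auto simp: transpose_def\<close>)
  then show ?case by (simp add: numeral_eq_Suc)
qed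

definition mcom :: "nat \<Rightarrow> nat \<Rightarrow> nat \<Rightarrow> nat \<Rightarrow> bool" where
  "mcom a b c d \<longleftrightarrow> m a b \<otimes> m c d = m c d \<otimes> m a b"

lemma mcom_transpose:
  assumes "mcom a b c d" "k \<in> {1..<n}" "a \<in> {1..n}" "b \<in> {1..n}" "c \<in> {1..n}" "d \<in> {1..n}"
    "distinct [a, b, c, d]"
    "transpose k (k+1) a = a'" "transpose k (k+1) b = b'"
    "transpose k (k+1) c = c'" "transpose k (k+1) d = d'"
  shows "mcom a' b' c' d'"
proof -
  have "cj k (m a b \<otimes> m c d) = cj k (m c d \<otimes> m a b)"
    using assms by (simp add: mcom_def)
  then show ?thesis using assms(2-)
    by (simp add: cj_mult m_equivariantD mcom_def)
qed

text \<open>The second pair is moved up first, with \<open>1\<close> and \<open>2\<close> fixed;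
  \<open>mcom_adjacent\<close> then moves the first pair up below it.\<close>

lemma mcom_1_2: "\<lbrakk>3 \<le> j; j + 1 \<le> n\<rbrakk> \<Longrightarrow> mcom 1 2 j (j + 1)"
proof (induction j rule: dec_induct)
  case base
  then show ?case using m_comm by (simp add: mcom_def)
next
  case (step j)
  have "mcom 1 2 j (j+1)" using step by simp
  then have "mcom 1 2 j (j+2)"
    by (rule mcom_transpose[where k = "j+1"]) (use step in \<open>auto simp: transpose_def\<close>)
  then have "mcom 1 2 (j+1) (j+2)"
    by (rule mcom_transpose[where k = "j"]) (use step in \<open>auto simp: transpose_def\<close>)
  then show ?case by (simp add: numeral_eq_Suc)
qed

lemma mcom_adjacent: "\<lbrakk>1 \<le> i; i + 1 < j; j + 1 \<le> n\<rbrakk> \<Longrightarrow> mcom i (i + 1) j (j + 1)"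
proof (induction i rule: dec_induct)
  case base
  then show ?case using mcom_1_2[of j] by (simp add: numeral_eq_Suc)
next
  case (step i)
  have "mcom i (i+1) j (j+1)" using step by simp
  then have "mcom i (i+2) j (j+1)"
    by (rule mcom_transpose[where k = "i+1"]) (use step in \<open>auto simp: transpose_def\<close>)
  then have "mcom (i+1) (i+2) j (j+1)"
    by (rule mcom_transpose[where k = "i"]) (use step in \<open>auto simp: transpose_def\<close>)
  then show ?case by (simp add: numeral_eq_Suc)
qed

definition ms :: "nat \<Rightarrow> 'a" where
  "ms i = m i (i + 1) \<otimes> v i"

lemma v_m: "\<lbrakk>k \<in> {1..<n}; i \<in> {1..n}; j \<in> {1..n}; i \<noteq> j\<rbrakk> \<Longrightarrow>
    v k \<otimes> m i j = m (transpose k (k+1) i) (transpose k (k+1) j) \<otimes> v k"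
  by (rule cj_v) (use m_equivariant in auto)

text \<open>As a rewrite rule on right-nested products this collects all \<open>m\<close> factors on
  the left and all \<open>v\<close> factors on the right.\<close>

lemma v_m_assoc: "\<lbrakk>k \<in> {1..<n}; i \<in> {1..n}; j \<in> {1..n}; i \<noteq> j; x \<in> carrier G\<rbrakk> \<Longrightarrow>
    v k \<otimes> (m i j \<otimes> x) = m (transpose k (k+1) i) (transpose k (k+1) j) \<otimes> (v k \<otimes> x)"
  using v_m[of k i j] m_equivariant[of k i j] cj_closed[of k "m i j"]
  by (simp flip: m_assoc)

lemma vbraid_family_ms: "vbraid_family G n v ms"
proof unfold_locales
  show ms_closed: "ms i \<in> carrier G" if "i \<in> {1..<n}" for i using that by (simp add: ms_def)
  show "ms i \<otimes> (ms (i+1) \<otimes> ms i) = ms (i+1) \<otimes> (ms i \<otimes> ms (i+1))"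
    if i: "i \<in> {1..<n}" "i + 1 \<in> {1..<n}" for i
  proof -
    have cl: "m i (i+1) \<in> carrier G" "m i (i+2) \<in> carrier G" "m (i+1) (i+2) \<in> carrier G"
      "v i \<in> carrier G" "v (i+1) \<in> carrier G"
      using i by auto
    \<comment> \<open>The collected form separates an \<open>m\<close> word from a \<open>v\<close>
      word, so Yang-Baxter and the braid relation of the \<open>v i\<close> apply
      independently.\<close>
    have "ms i \<otimes> (ms (i+1) \<otimes> ms i)
        = (m i (i+1) \<otimes> (m i (i+2) \<otimes> m (i+1) (i+2))) \<otimes> (v i \<otimes> (v (i+1) \<otimes> v i))"
      using i cl by (simp add: ms_def m_assoc v_m_assoc transpose_def)
    also have "\<dots> = (m (i+1) (i+2) \<otimes> (m i (i+2) \<otimes> m i (i+1))) \<otimes> (v (i+1) \<otimes> (v i \<otimes> v (i+1)))"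
      using yb_adjacent[of i] v_braid[OF i] i by (simp add: yb_def)
    also have "\<dots> = ms (i+1) \<otimes> (ms i \<otimes> ms (i+1))"
      using i cl by (simp add: ms_def m_assoc v_m_assoc transpose_def)
    finally show ?thesis .
  qed
  show v_ms: "ms i \<otimes> v j = v j \<otimes> ms i"
    if "i \<in> {1..<n}" "j \<in> {1..<n}" "\<bar>int i - int j\<bar> > 1" for i j
  proof -
    have "transpose j (Suc j) i = i" "transpose j (Suc j) (Suc i) = Suc i"
      using that by (auto simp: transpose_def)
    then show ?thesis
      using that v_comm[OF that] by (simp add: ms_def m_assoc v_m_assoc)
  qed
  \<comment> \<open>Only the ordered case, as in \<open>mcom_adjacent\<close>; the other follows by
    exchanging \<open>i\<close> and \<open>j\<close>.\<close>
  have comm: "ms i \<otimes> ms j = ms j \<otimes> ms i" if ij: "i \<in> {1..<n}" "j \<in> {1..<n}" "i + 1 < j" for i j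
  proof -
    have "transpose i (Suc i) j = j" "transpose i (Suc i) (Suc j) = Suc j"
      using ij by (auto simp: transpose_def)
    then have "v i \<otimes> m j (j+1) = m j (j+1) \<otimes> v i"
      using v_m[of i j "j+1"] ij by simp
    moreover have "m i (i+1) \<otimes> m j (j+1) = m j (j+1) \<otimes> m i (i+1)"
      using mcom_adjacent[of i j] ij by (simp add: mcom_def)
    moreover have cl: "m j (j+1) \<in> carrier G" "m i (i+1) \<in> carrier G"
        "v i \<in> carrier G" "v j \<in> carrier G"
      using ij by auto
    ultimately have "ms i \<otimes> m j (j+1) = m j (j+1) \<otimes> ms i"
      unfolding ms_def by (metis m_assoc)
    moreover have "ms i \<otimes> v j = v j \<otimes> ms i" using ij by (intro v_ms) auto
    ultimately show ?thesis
      unfolding ms_def[of j] using cl ms_closed[OF ij(1)] by (metis m_assoc)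
  qed
  show "ms i \<otimes> ms j = ms j \<otimes> ms i"
    if "i \<in> {1..<n}" "j \<in> {1..<n}" "\<bar>int i - int j\<bar> > 1" for i j
    using comm[of i j] comm[of j i] that by (cases "i < j") auto
  \<comment> \<open>Both sides collect to \<open>m i (i+2)\<close> followed by a side of the braid
    relation of the \<open>v i\<close>.\<close>
  show "v i \<otimes> (ms (i+1) \<otimes> v i) = v (i+1) \<otimes> (ms i \<otimes> v (i+1))"
    if i: "i \<in> {1..<n}" "i + 1 \<in> {1..<n}" for i
    using i v_braid[OF i] by (simp add: ms_def m_assoc v_m_assoc transpose_def)
qed

end

text \<open>\<open>K\<close> intertwines the two conjugations. Starting from adjacent increasing
  pairs, one swap reaches the decreasing ones, and raising the larger index reaches all others. This
  identifies the images of the elements \<open>sm i j\<close> without unfolding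
  \<open>push\<close>.\<close>

lemma stringy_hom_determined:
  assumes "stringy_family G n v m" "stringy_family H n w m'" "K \<in> hom G H"
    and v: "\<And>k. k \<in> {1..<n} \<Longrightarrow> K (v k) = w k"
    and adj: "\<And>i. i \<in> {1..<n} \<Longrightarrow> K (m i (i+1)) = m' i (i+1)"
    and ij: "i \<in> {1..n}" "j \<in> {1..n}" "i \<noteq> j"
  shows "K (m i j) = m' i j"
proof -
  interpret G: stringy_family G n v m by (rule assms(1))
  interpret H: stringy_family H n w m' by (rule assms(2))
  interpret K: group_hom G H K by unfold_locales (rule assms(3))
  have K_cj: "K (G.cj k x) = H.cj k (K x)" if "k \<in> {1..<n}" "x \<in> carrier G" for k x
    using that v by (simp add: G.cj_def H.cj_def)
  have step: "K (m a' b') = m' a' b'"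
    if "K (m a b) = m' a b" "k \<in> {1..<n}" "a \<in> {1..n}" "b \<in> {1..n}" "a \<noteq> b"
      "transpose k (k+1) a = a'" "transpose k (k+1) b = b'" for a b a' b' k
    using that(1) K_cj[OF that(2) G.mu_closed[OF that(3-5)]]
    by (simp only: G.m_equivariantD[OF that(2-7)] H.m_equivariantD[OF that(2-7)])
  have "K (m i (i+d+1)) = m' i (i+d+1) \<and> K (m (i+d+1) i) = m' (i+d+1) i"
    if "1 \<le> i" "i + d + 1 \<le> n" for i d
    using that(2)
  proof (induction d)
    case 0
    then have "K (m i (i+1)) = m' i (i+1)" using adj that(1) by simp
    moreover from this have "K (m (i+1) i) = m' (i+1) i"
      by (rule step[where k = i]) (use 0 that(1) in auto)
    ultimately show ?case by simp
  next
    case (Suc d)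
    then have IH: "K (m i (i+d+1)) = m' i (i+d+1)" "K (m (i+d+1) i) = m' (i+d+1) i" by auto
    have "K (m i (i+d+2)) = m' i (i+d+2)"
      by (rule step[OF IH(1), where k = "i+d+1"]) (use Suc that(1) in \<open>auto simp: transpose_def\<close>)
    moreover have "K (m (i+d+2) i) = m' (i+d+2) i"
      by (rule step[OF IH(2), where k = "i+d+1"]) (use Suc that(1) in \<open>auto simp: transpose_def\<close>)
    ultimately show ?case by simp
  qed
  from this[of i "j - i - 1"] this[of j "i - j - 1"] show ?thesis
    using ij by (cases "i < j") auto
qed

section \<open>The relations of the two presentations\<close>

lemma (in sym_family) word_eval_sym_rels:
  assumes "(r, s) \<in> sym_rels x n" and h: "\<And>k. k \<in> {1..<n} \<Longrightarrow> h (x k) = v k"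
  shows "word_eval G h r = word_eval G h s"
  using assms(1) unfolding sym_rels_def
  by (auto simp: gen_def word_eval_Cons h v_sq intro!: v_braid[simplified] v_comm)

lemma (in vbraid_family) word_eval_VB_rels:
  assumes "(r, r') \<in> VB_rels n"
  shows "word_eval G (case_vb_gen s v) r = word_eval G (case_vb_gen s v) r'"
proof (cases "(r, r') \<in> sym_rels VBv n")
  case True
  then show ?thesis by (rule word_eval_sym_rels) simp
next
  case False
  then show ?thesis using assms unfolding VB_rels_def
    by (auto simp: gen_def word_eval_Cons intro!: s_braid[simplified] s_comm s_mixed[simplified] s_v_comm)
qed

lemma adj_prod_range:
  assumes "set ks \<subseteq> {1..<n}" "i \<in> {1..n}" "j \<in> {1..n}" "i \<noteq> j"
  shows "adj_prod ks i \<in> {1..n} \<and> adj_prod ks j \<in> {1..n} \<and> adj_prod ks i \<noteq> adj_prod ks j"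
  using assms by (induction ks) (auto simp: adj_prod_def transpose_def)

text \<open>The presentation imposes conjugation by every word in the \<open>v k\<close>, the locale
  only by single letters. Since \<open>winv\<close> reverses words, the first letter of
  \<open>ks\<close> supplies the outermost factors on both sides, and induction applies.\<close>

lemma (in stringy_family) word_eval_conj:
  fixes h :: "vs_gen \<Rightarrow> 'a"
  defines "h \<equiv> case_vs_gen m v"
  assumes "set ks \<subseteq> {1..<n}" "i \<in> {1..n}" "j \<in> {1..n}" "i \<noteq> j"
  shows "word_eval G h (perm_word ks @ gen (Mu i j) @ winv (perm_word ks))
    = m (adj_prod ks i) (adj_prod ks j)"
  using assms(2)
proof (induction ks)
  case Nil
  then show ?case
    using assms by (simp add: perm_word_def winv_def gen_def word_eval_Cons adj_prod_def)
next
  case (Cons k ks)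
  let ?w = "perm_word ks @ gen (Mu i j) @ winv (perm_word ks)"
  have k: "k \<in> {1..<n}" and ks: "set ks \<subseteq> {1..<n}" using Cons.prems by auto
  have h: "h ` VS_gens n \<subseteq> carrier G" by (auto simp: h_def VS_gens_def)
  have winv: "winv w \<in> gwords X" if "w \<in> gwords X" for w :: "vs_gen gword" and X
    using that by (auto simp: winv_def gwords_def)
  have w: "?w \<in> gwords (VS_gens n)"
    using assms perm_word_words[OF ks] winv by (auto simp: gwords_simps VS_gens_def)
  have vk: "[(VSv k, False)] \<in> gwords (VS_gens n)" using k by (auto simp: gwords_def VS_gens_def)
  have eq: "perm_word (k # ks) @ gen (Mu i j) @ winv (perm_word (k # ks))
      = (VSv k, True) # (?w @ [(VSv k, False)])"
    by (simp add: perm_word_def winv_def gen_def)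
  have "word_eval G h (perm_word (k # ks) @ gen (Mu i j) @ winv (perm_word (k # ks)))
      = cj k (word_eval G h ?w)"
    unfolding eq word_eval_Cons word_eval_append[OF h w vk]
    using k by (simp add: h_def word_eval_Cons cj_def v_inv)
  also have "\<dots> = cj k (m (adj_prod ks i) (adj_prod ks j))" using Cons.IH[OF ks] by simp
  also have "\<dots> = m (adj_prod (k # ks) i) (adj_prod (k # ks) j)"
    using adj_prod_range[OF ks assms(3-5)] k by (simp add: m_equivariant) (simp add: adj_prod_def)
  finally show ?case .
qed

lemma (in stringy_family) word_eval_VS_rels:
  assumes "(r, s) \<in> VS_rels n"
  shows "word_eval G (case_vs_gen m v) r = word_eval G (case_vs_gen m v) s"
proof -
  consider "(r, s) \<in> sym_rels VSv n"
    | \<tau> ks i j where "r = perm_word ks @ gen (Mu i j) @ winv (perm_word ks)" "s = gen (Mu (\<tau> i) (\<tau> j))"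
        "set ks \<subseteq> {1..<n}" "\<tau> = adj_prod ks" "i \<in> {1..n}" "j \<in> {1..n}" "i \<noteq> j"
    | "n \<ge> 3" "r = gen (Mu 1 2) @ gen (Mu 1 3) @ gen (Mu 2 3)"
        "s = gen (Mu 2 3) @ gen (Mu 1 3) @ gen (Mu 1 2)"
    | "n \<ge> 4" "r = gen (Mu 1 2) @ gen (Mu 3 4)" "s = gen (Mu 3 4) @ gen (Mu 1 2)"
    using assms unfolding VS_rels_def by (auto split: if_splits)
  then show ?thesis
  proof cases
    case 1
    then show ?thesis by (rule word_eval_sym_rels) simp
  next
    case 2
    then show ?thesis
      using word_eval_conj[of ks i j] adj_prod_range[of ks n i j]
      by (simp add: gen_def word_eval_Cons)
  next
    case 3
    then show ?thesis using m_yang_baxter by (simp add: gen_def word_eval_Cons)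
  next
    case 4
    then show ?thesis using m_comm by (simp add: gen_def word_eval_Cons)
  qed
qed

section \<open>The two presented groups as instances of the locales, and the isomorphism\<close>

abbreviation VB_gen :: "nat \<Rightarrow> vb_gen \<Rightarrow> vb_gen gword set" where
  "VB_gen n \<equiv> pgen (VB_gens n) (VB_rels n)"

abbreviation VS_gen :: "nat \<Rightarrow> vs_gen \<Rightarrow> vs_gen gword set" where
  "VS_gen n \<equiv> pgen (VS_gens n) (VS_rels n)"

lemma sym_family_presented:
  assumes "group G" and closed: "\<And>k. k \<in> {1..<n} \<Longrightarrow> h (x k) \<in> carrier G"
    and rels: "\<And>r s. (r, s) \<in> sym_rels x n \<Longrightarrow> word_eval G h r = word_eval G h s"
  shows "sym_family G n (\<lambda>k. h (x k))"
proof -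
  interpret group G by (rule assms(1))
  show ?thesis
  proof unfold_locales
    fix k assume k: "k \<in> {1..<n}"
    show "h (x k) \<in> carrier G" using closed k .
    have "(gen (x k) @ gen (x k), []) \<in> sym_rels x n" using k by (auto simp: sym_rels_def)
    from rels[OF this] show "h (x k) \<otimes>\<^bsub>G\<^esub> h (x k) = \<one>\<^bsub>G\<^esub>"
      using closed[OF k] by (simp add: gen_def word_eval_Cons)
    show "h (x k) \<otimes>\<^bsub>G\<^esub> (h (x (k+1)) \<otimes>\<^bsub>G\<^esub> h (x k)) = h (x (k+1)) \<otimes>\<^bsub>G\<^esub> (h (x k) \<otimes>\<^bsub>G\<^esub> h (x (k+1)))"
      if k1: "k + 1 \<in> {1..<n}"
    proof -
      have "(gen (x k) @ gen (x (k+1)) @ gen (x k), gen (x (k+1)) @ gen (x k) @ gen (x (k+1)))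
          \<in> sym_rels x n"
        using k k1 unfolding sym_rels_def by blast
      from rels[OF this] show ?thesis
        using closed[OF k] closed[OF k1] by (simp add: gen_def word_eval_Cons)
    qed
    show "h (x k) \<otimes>\<^bsub>G\<^esub> h (x l) = h (x l) \<otimes>\<^bsub>G\<^esub> h (x k)"
      if l: "l \<in> {1..<n}" "\<bar>int k - int l\<bar> > 1" for l
    proof -
      have "(gen (x k) @ gen (x l), gen (x l) @ gen (x k)) \<in> sym_rels x n"
        using k l unfolding sym_rels_def by blast
      from rels[OF this] show ?thesis
        using closed[OF k] closed[OF l(1)] by (simp add: gen_def word_eval_Cons)
    qed
  qed
qed

lemma vbraid_family_VB:
  "vbraid_family (VB n) n (\<lambda>i. VB_gen n (VBv i)) (\<lambda>i. VB_gen n (Sigma i))"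
proof -
  have rels: "word_eval (VB n) (VB_gen n) r = word_eval (VB n) (VB_gen n) s"
    if "(r, s) \<in> VB_rels n" for r s
    unfolding VB_def by (rule word_eval_pgen_rel[OF VB_rels_words that])
  have closed: "VB_gen n (VBv i) \<in> carrier (VB n)" "VB_gen n (Sigma i) \<in> carrier (VB n)"
    if "i \<in> {1..<n}" for i
    using that pgen_closed[OF VB_rels_words[of n]] by (auto simp: VB_def VB_gens_def)
  interpret sym_family "VB n" n "\<lambda>i. VB_gen n (VBv i)"
    by (rule sym_family_presented[OF group_VB closed(1) rels]) (auto simp: VB_rels_def)
  note ev = gen_def word_eval_Cons closed
  show ?thesis
  proof unfold_locales
    fix i assume i: "i \<in> {1..<n}"
    show "VB_gen n (Sigma i) \<in> carrier (VB n)" using closed(2)[OF i] .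
    show "VB_gen n (Sigma i) \<otimes>\<^bsub>VB n\<^esub> (VB_gen n (Sigma (i+1)) \<otimes>\<^bsub>VB n\<^esub> VB_gen n (Sigma i))
        = VB_gen n (Sigma (i+1)) \<otimes>\<^bsub>VB n\<^esub> (VB_gen n (Sigma i) \<otimes>\<^bsub>VB n\<^esub> VB_gen n (Sigma (i+1)))"
      if i1: "i + 1 \<in> {1..<n}"
    proof -
      have "(gen (Sigma i) @ gen (Sigma (i+1)) @ gen (Sigma i),
          gen (Sigma (i+1)) @ gen (Sigma i) @ gen (Sigma (i+1))) \<in> VB_rels n"
        using i i1 unfolding VB_rels_def by blast
      from rels[OF this] show ?thesis using i i1 by (simp add: ev)
    qed
    show "VB_gen n (VBv i) \<otimes>\<^bsub>VB n\<^esub> (VB_gen n (Sigma (i+1)) \<otimes>\<^bsub>VB n\<^esub> VB_gen n (VBv i))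
        = VB_gen n (VBv (i+1)) \<otimes>\<^bsub>VB n\<^esub> (VB_gen n (Sigma i) \<otimes>\<^bsub>VB n\<^esub> VB_gen n (VBv (i+1)))"
      if i1: "i + 1 \<in> {1..<n}"
    proof -
      have "(gen (VBv i) @ gen (Sigma (i+1)) @ gen (VBv i),
          gen (VBv (i+1)) @ gen (Sigma i) @ gen (VBv (i+1))) \<in> VB_rels n"
        using i i1 unfolding VB_rels_def by blast
      from rels[OF this] show ?thesis using i i1 by (simp add: ev)
    qed
    show "VB_gen n (Sigma i) \<otimes>\<^bsub>VB n\<^esub> VB_gen n (Sigma j) = VB_gen n (Sigma j) \<otimes>\<^bsub>VB n\<^esub> VB_gen n (Sigma i)"
      if j: "j \<in> {1..<n}" "\<bar>int i - int j\<bar> > 1" for j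
    proof -
      have "(gen (Sigma i) @ gen (Sigma j), gen (Sigma j) @ gen (Sigma i)) \<in> VB_rels n"
        using i j unfolding VB_rels_def by blast
      from rels[OF this] show ?thesis using i j by (simp add: ev)
    qed
    show "VB_gen n (Sigma i) \<otimes>\<^bsub>VB n\<^esub> VB_gen n (VBv j) = VB_gen n (VBv j) \<otimes>\<^bsub>VB n\<^esub> VB_gen n (Sigma i)"
      if j: "j \<in> {1..<n}" "\<bar>int i - int j\<bar> > 1" for j
    proof -
      have "(gen (Sigma i) @ gen (VBv j), gen (VBv j) @ gen (Sigma i)) \<in> VB_rels n"
        using i j unfolding VB_rels_def by blast
      from rels[OF this] show ?thesis using i j by (simp add: ev)
    qed
  qed
qed

lemma stringy_family_VS:
  "stringy_family (VS n) n (\<lambda>i. VS_gen n (VSv i)) (\<lambda>i j. VS_gen n (Mu i j))"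
proof -
  have rels: "word_eval (VS n) (VS_gen n) r = word_eval (VS n) (VS_gen n) s"
    if "(r, s) \<in> VS_rels n" for r s
    unfolding VS_def by (rule word_eval_pgen_rel[OF VS_rels_words that])
  have closed: "i \<in> {1..<n} \<Longrightarrow> VS_gen n (VSv i) \<in> carrier (VS n)"
    "\<lbrakk>i \<in> {1..n}; j \<in> {1..n}; i \<noteq> j\<rbrakk> \<Longrightarrow> VS_gen n (Mu i j) \<in> carrier (VS n)" for i j
    using pgen_closed[OF VS_rels_words[of n]] by (auto simp: VS_def VS_gens_def)
  interpret sym_family "VS n" n "\<lambda>i. VS_gen n (VSv i)"
    by (rule sym_family_presented[OF group_VS closed(1) rels]) (auto simp: VS_rels_def)
  note ev = gen_def word_eval_Cons
  show ?thesis
  proof unfold_locales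
    show "VS_gen n (Mu i j) \<in> carrier (VS n)" if "i \<in> {1..n}" "j \<in> {1..n}" "i \<noteq> j" for i j
      using closed(2) that .
    show "cj k (VS_gen n (Mu i j)) = VS_gen n (Mu (transpose k (k+1) i) (transpose k (k+1) j))"
      if k: "k \<in> {1..<n}" and ij: "i \<in> {1..n}" "j \<in> {1..n}" "i \<noteq> j" for k i j
    proof -
      \<comment> \<open>The one-letter word \<open>[k]\<close> already yields the conjugation law of
        the locale.\<close>
      have "transpose k (k+1) permutes {1..n}" using k by (intro permutes_swap_id) auto
      moreover have "transpose k (k+1) = adj_prod [k]" by (simp add: adj_prod_def)
      moreover have "set [k] \<subseteq> {1..<n}" using k by simp
      ultimately have "(perm_word [k] @ gen (Mu i j) @ winv (perm_word [k]),
          gen (Mu (transpose k (k+1) i) (transpose k (k+1) j))) \<in> VS_rels n"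
        using ij unfolding VS_rels_def by blast
      from rels[OF this] show ?thesis
        using k ij closed(2)[OF ij] adj_prod_range[of "[k]" n i j]
          closed(2)[of "transpose k (k+1) i" "transpose k (k+1) j"]
        by (simp add: ev perm_word_def winv_def v_inv cj_def adj_prod_def)
    qed
    show "VS_gen n (Mu 1 2) \<otimes>\<^bsub>VS n\<^esub> (VS_gen n (Mu 1 3) \<otimes>\<^bsub>VS n\<^esub> VS_gen n (Mu 2 3))
        = VS_gen n (Mu 2 3) \<otimes>\<^bsub>VS n\<^esub> (VS_gen n (Mu 1 3) \<otimes>\<^bsub>VS n\<^esub> VS_gen n (Mu 1 2))" if "n \<ge> 3"
    proof -
      have "(gen (Mu 1 2) @ gen (Mu 1 3) @ gen (Mu 2 3), gen (Mu 2 3) @ gen (Mu 1 3) @ gen (Mu 1 2))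
          \<in> VS_rels n"
        using that unfolding VS_rels_def by simp
      from rels[OF this] show ?thesis using that by (simp add: ev closed(2))
    qed
    show "VS_gen n (Mu 1 2) \<otimes>\<^bsub>VS n\<^esub> VS_gen n (Mu 3 4) = VS_gen n (Mu 3 4) \<otimes>\<^bsub>VS n\<^esub> VS_gen n (Mu 1 2)"
      if "n \<ge> 4"
    proof -
      have "(gen (Mu 1 2) @ gen (Mu 3 4), gen (Mu 3 4) @ gen (Mu 1 2)) \<in> VS_rels n"
        using that unfolding VS_rels_def by simp
      from rels[OF this] show ?thesis using that by (simp add: ev closed(2))
    qed
  qed
qed

theorem theorem1:
  fixes n :: nat
  assumes "n \<ge> 2"
  shows "VS n \<cong> VB n"
proof -
  interpret B: vbraid_family "VB n" n "\<lambda>i. VB_gen n (VBv i)" "\<lambda>i. VB_gen n (Sigma i)"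
    by (rule vbraid_family_VB)
  interpret S: stringy_family "VS n" n "\<lambda>i. VS_gen n (VSv i)" "\<lambda>i j. VS_gen n (Mu i j)"
    by (rule stringy_family_VS)
  \<comment> \<open>\<open>BS\<close> and \<open>SB\<close> provide the images of the generators
    under \<open>F\<close> and \<open>K\<close>, together with the relations that make these
    homomorphisms exist.\<close>
  interpret BS: stringy_family "VB n" n "\<lambda>i. VB_gen n (VBv i)" B.sm
    by (rule B.stringy_family_sm)
  interpret SB: vbraid_family "VS n" n "\<lambda>i. VS_gen n (VSv i)" S.ms
    by (rule S.vbraid_family_ms)
  have "case_vs_gen B.sm (\<lambda>i. VB_gen n (VBv i)) ` VS_gens n \<subseteq> carrier (VB n)"
    by (auto simp: VS_gens_def)
  then obtain F where F: "F \<in> hom (VS n) (VB n)"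
    and F_gens: "\<And>x. x \<in> VS_gens n \<Longrightarrow> F (VS_gen n x) = case_vs_gen B.sm (\<lambda>i. VB_gen n (VBv i)) x"
    unfolding VS_def[of n]
    using presented_group_hom_extend[OF VS_rels_words group_VB _ BS.word_eval_VS_rels] by metis
  have "case_vb_gen S.ms (\<lambda>i. VS_gen n (VSv i)) ` VB_gens n \<subseteq> carrier (VS n)"
    by (auto simp: VB_gens_def)
  then obtain K where K: "K \<in> hom (VB n) (VS n)"
    and K_gens: "\<And>x. x \<in> VB_gens n \<Longrightarrow> K (VB_gen n x) = case_vb_gen S.ms (\<lambda>i. VS_gen n (VSv i)) x"
    unfolding VB_def[of n]
    using presented_group_hom_extend[OF VB_rels_words group_VS _ SB.word_eval_VB_rels] by metis
  interpret F: group_hom "VS n" "VB n" F by unfold_locales (rule F)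
  interpret K: group_hom "VB n" "VS n" K by unfold_locales (rule K)
  have Fv: "F (VS_gen n (VSv i)) = VB_gen n (VBv i)" if "i \<in> {1..<n}" for i
    using F_gens that by (simp add: VS_gens_def)
  have Fm: "F (VS_gen n (Mu i j)) = B.sm i j" if "i \<in> {1..n}" "j \<in> {1..n}" "i \<noteq> j" for i j
    using F_gens[of "Mu i j"] that by (simp add: VS_gens_def)
  have Kv: "K (VB_gen n (VBv i)) = VS_gen n (VSv i)" if "i \<in> {1..<n}" for i
    using K_gens that by (simp add: VB_gens_def)
  have Ks: "K (VB_gen n (Sigma i)) = S.ms i" if "i \<in> {1..<n}" for i
    using K_gens that by (simp add: VB_gens_def)
  have Km: "K (B.sm i j) = VS_gen n (Mu i j)" if "i \<in> {1..n}" "j \<in> {1..n}" "i \<noteq> j" for i j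
  proof (rule stringy_hom_determined[OF B.stringy_family_sm stringy_family_VS K Kv _ that])
    \<comment> \<open>Adjacent pairs suffice: the \<open>v\<close> factor of \<open>S.ms i\<close>
      cancels against the one in \<open>B.sm i (i+1)\<close>.\<close>
    show "K (B.sm i (i+1)) = VS_gen n (Mu i (i+1))" if "i \<in> {1..<n}" for i
      using that by (simp add: B.sm_adjacent Kv Ks S.ms_def S.m_assoc S.v_sq)
  qed
  have KF: "K (F x) = x" if "x \<in> carrier (VS n)" for x
  proof -
    have "K \<circ> F \<in> hom (VS n) (VS n)" using F K by (rule hom_compose)
    moreover have "(K \<circ> F) (VS_gen n g) = VS_gen n g" if "g \<in> VS_gens n" for g
      using that Fv Fm Kv Km by (auto simp: VS_gens_def)
    ultimately show ?thesis
      using presented_group_hom_id[OF VS_rels_words, of "K \<circ> F" n x] that by (simp add: VS_def)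
  qed
  have FK: "F (K y) = y" if "y \<in> carrier (VB n)" for y
  proof -
    have "F (S.ms i) = VB_gen n (Sigma i)" if "i \<in> {1..<n}" for i
      using that by (simp add: S.ms_def Fv Fm B.sm_adjacent B.m_assoc B.v_sq)
    then have "(F \<circ> K) (VB_gen n g) = VB_gen n g" if "g \<in> VB_gens n" for g
      using that Fv Kv Ks by (auto simp: VB_gens_def)
    moreover have "F \<circ> K \<in> hom (VB n) (VB n)" using K F by (rule hom_compose)
    ultimately show ?thesis
      using presented_group_hom_id[OF VB_rels_words, of "F \<circ> K" n y] that by (simp add: VB_def)
  qed
  show ?thesis by (rule iso_by_inverse_homs[OF F K KF FK])
qed

end
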